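(* Let $m,d$ be integers with $1\leq m<d$, and let $$p\in\left[1,\ \frac{2\log\frac{2m+1}{2m}}{\log\frac{m+1}{m}}\right].$$ Let $\mathbf{A}=(A_{ij})$ be a real $(d+m)\times(d+m)$ matrix of rank $d$ with ones along the diagonal. Then $$E_p(\mathbf{A})=\sum_{i\neq j}|A_{ij}|^p\;\geq\; 2m.$$
   Context: For a real $N\times N$ matrix $\mathbf{A}=(A_{ij})$ and $p>0$, the $p$-frame energy is $E_p(\mathbf{A})=\sum_{i\neq j}|A_{ij}|^p$, the sum running over all ordered pairs $(i,j)$ with $i\neq j$. The matrix $\mathbf{A}$ is not assumed symmetric or positive semidefinite. *)

theory Defs
  imports "HOL-Analysis.Analysis"
begin

text \<open>The exponent is real, so the power is \<^const>\<open>powr\<close>; as \<open>0 powr p = 0\<close>, zero entries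
  contribute \<open>0\<close>, as they should for \<open>p > 0\<close>.\<close>

definition frame_energy :: "real \<Rightarrow> real ^ 'n ^ 'n \<Rightarrow> real" where
  "frame_energy p A = (\<Sum>(i, j) \<in> {(i, j). i \<noteq> j}. \<bar>A $ i $ j\<bar> powr p)"

end

theory Submission
  imports Defs
begin

text \<open>
  Let \<open>P\<close> be the orthogonal projection onto the kernel of \<open>A\<close>, which has dimension \<open>m\<close>, and let
  \<open>x\<^sub>i = P\<^sub>i\<^sub>i\<close>. Then \<open>0 \<le> x\<^sub>i < 1\<close> and the \<open>x\<^sub>i\<close> add up to the trace \<open>m\<close>. The \<open>i\<close>-th column of \<open>P\<close> lies in
  the kernel, so it is orthogonal to the \<open>i\<close>-th row of \<open>A\<close>, whose \<open>i\<close>-th entry is \<open>1\<close>. By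
  Cauchy--Schwarz the off-diagonal part of that row is then so large that its energy is at least
  \<open>f(x\<^sub>i)\<close>, where \<open>f(x) = (x / (1 - x)) powr (p / 2)\<close> (\<open>frame_energy_ge_kernel_sum\<close>). It remains to
  show that \<open>\<Sum>i. f(x\<^sub>i) \<ge> 2 m\<close> whenever the \<open>x\<^sub>i\<close> lie in \<open>[0, 1)\<close> and have sum \<open>m\<close>
  (\<open>sum_odds_powr_ge\<close>).

  For \<open>p = 1\<close> this holds termwise, as \<open>f(x) \<ge> 2 x\<close>. For \<open>p > 1\<close> that inequality fails for \<open>x\<close> slightly
  below \<open>1 / 2\<close>, while \<open>2 m\<close> numbers equal to \<open>1 / 2\<close>, with all others zero, still give equality. The
  competing configuration is \<open>2 m + 1\<close> numbers equal to \<open>a = m / (2 m + 1)\<close>, and the upper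
  bound on \<open>p\<close> says precisely that it does not give less than \<open>2 m\<close>. Any configuration is compared
  with one of these two, according to the number \<open>k\<close> of indices with \<open>x\<^sub>i > 1 / 10\<close>.

  If \<open>k \<le> 2 m\<close>, the tangent to \<open>f\<close> at \<open>1 / 2\<close> is used at these indices and the line through the
  origin with the same slope \<open>2 p\<close> at the others. The total is \<open>2 p m - (p - 1) k \<ge> 2 m\<close>.

  If \<open>k \<ge> 2 m + 1\<close>, the tangent at \<open>a\<close> is used instead, taken for the largest admissible exponent,
  with the line of the same slope through the origin at the other indices. Its intercept is
  nonnegative, so the total is least for \<open>k = 2 m + 1\<close>, and then it is \<open>2 m + 1\<close> times the value \<open>2 a\<close>
  of the tangent at \<open>a\<close>, that is, \<open>2 m\<close>. The main work is to show that this tangent stays below \<open>f\<close> on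
  \<open>[1 / 10, 1)\<close> (\<open>line_le_odds_powr\<close>); close to \<open>0\<close> it does not. The threshold \<open>1 / 10\<close> is chosen
  so that \<open>f(x) \<ge> 2 p x\<close> holds below it and the tangent is valid above it, for all \<open>m\<close> at once.
\<close>

section \<open>Subadditivity of concave powers\<close>

lemma powr_add_subadditive:
  fixes u v s :: real
  assumes "0 \<le> u" "0 \<le> v" "0 \<le> s" "s \<le> 1"
  shows "(u + v) powr s \<le> u powr s + v powr s"
proof (cases "u + v = 0")
  case False
  with assms have pos: "u + v > 0" by simp
  have *: "w / (u + v) * (u + v) powr s \<le> w powr s" if "0 \<le> w" "w \<le> u + v" for w
  proof -
    have "w / (u + v) \<le> (w / (u + v)) powr s"
      using powr_mono'[of s 1 "w / (u + v)"] that pos assms by auto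
    also have "\<dots> = w powr s / (u + v) powr s"
      using that pos by (simp add: powr_divide)
    finally show ?thesis
      using pos by (simp add: pos_le_divide_eq del: times_divide_eq_left)
  qed
  have "(u + v) powr s = u / (u + v) * (u + v) powr s + v / (u + v) * (u + v) powr s"
  proof -
    have "u / (u + v) + v / (u + v) = 1" using pos by (simp flip: add_divide_distrib)
    then show ?thesis by (metis distrib_right mult_1)
  qed
  also have "\<dots> \<le> u powr s + v powr s"
    using *[of u] *[of v] assms by simp
  finally show ?thesis .
qed (use assms in auto)

lemma powr_sum_subadditive:
  fixes g :: "'b \<Rightarrow> real"
  assumes "finite J" "\<And>j. j \<in> J \<Longrightarrow> 0 \<le> g j" "0 \<le> s" "s \<le> 1"
  shows "(\<Sum>j\<in>J. g j) powr s \<le> (\<Sum>j\<in>J. g j powr s)"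
  using assms(1,2)
proof (induction J)
  case (insert a J)
  then have "(g a + sum g J) powr s \<le> g a powr s + sum g J powr s"
    using powr_add_subadditive[of "g a" "sum g J" s] assms(3,4) by (simp add: sum_nonneg)
  with insert show ?case by force
qed simp

section \<open>From the matrix to the projection onto its kernel\<close>

lemma dim_kernel:
  fixes A :: "real ^ 'n ^ 'm"
  shows "dim {x. A *v x = 0} + rank A = CARD('n)"
proof -
  have "{x. A *v x = 0} = {y \<in> UNIV. \<forall>x \<in> span (rows A). orthogonal x y}"
  proof -
    have "A *v y = 0 \<longleftrightarrow> (\<forall>x \<in> rows A. orthogonal x y)" for y
    proof -
      have "rows A = range (($) A)" by (auto simp: rows_def row_def vec_nth_inverse vec_lambda_eta)
      then show ?thesis by (simp add: vec_eq_iff matrix_vector_mul_component orthogonal_def)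
    qed
    moreover have "(\<forall>x \<in> span (rows A). orthogonal x y) \<longleftrightarrow> (\<forall>x \<in> rows A. orthogonal x y)" for y
      using orthogonal_to_span[of _ "rows A" y] span_base[of _ "rows A"]
      by (auto simp: orthogonal_commute)
    ultimately show ?thesis by auto
  qed
  then show ?thesis
    using dim_subspace_orthogonal_to_vectors[of "span (rows A)" UNIV]
    by (simp add: row_rank_def)
qed

text \<open>The vectors \<open>v i\<close> are the columns of the orthogonal projection \<open>P\<close> onto \<open>S\<close>. Idempotence and
  symmetry of \<open>P\<close> appear as \<open>v i \<bullet> v i = P\<^sub>i\<^sub>i\<close>, and the sum of the diagonal is the trace of \<open>P\<close>.
  Both follow from an orthonormal basis \<open>B\<close> of \<open>S\<close>, as \<open>v i = (\<Sum>b\<in>B. b\<^sub>i b)\<close>.\<close>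

lemma projection_column:
  fixes S :: "(real ^ 'n) set"
  assumes "subspace S"
  obtains v :: "'n \<Rightarrow> real ^ 'n" where
    "\<And>i. v i \<in> S" "\<And>i. v i \<bullet> v i = v i $ i" "(\<Sum>i\<in>UNIV. v i $ i) = dim S"
proof -
  obtain B where B: "B \<subseteq> S" "pairwise orthogonal B" "\<And>b. b \<in> B \<Longrightarrow> norm b = 1"
    "independent B" "card B = dim S"
    using orthonormal_basis_subspace[OF assms] by metis
  have fin: "finite B" using B(4) independent_imp_finite by blast
  have on: "b \<bullet> c = (if b = c then 1 else 0)" if "b \<in> B" "c \<in> B" for b c
    using that B(2,3) by (auto simp: pairwise_def orthogonal_def norm_eq_1)
  define v where "v = (\<lambda>i. \<Sum>b\<in>B. (b $ i) *\<^sub>R b)"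
  have vi: "v i $ i = (\<Sum>b\<in>B. (b $ i)\<^sup>2)" for i
    by (simp add: v_def power2_eq_square)
  show thesis
  proof
    show "v i \<in> S" for i
      unfolding v_def using B(1) assms by (intro subspace_sum) (auto intro: subspace_scale)
    show "v i \<bullet> v i = v i $ i" for i
    proof -
      have "v i \<bullet> v i = (\<Sum>b\<in>B. \<Sum>c\<in>B. (b $ i * c $ i) * (b \<bullet> c))"
        unfolding v_def inner_sum_left inner_sum_right
        by (subst sum.swap) (simp add: mult.assoc mult.left_commute)
      also have "\<dots> = (\<Sum>b\<in>B. \<Sum>c\<in>B. if c = b then b $ i * b $ i else 0)"
        by (intro sum.cong) (auto simp: on)
      also have "\<dots> = v i $ i"
        using fin by (simp add: vi power2_eq_square)
      finally show ?thesis .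
    qed
    have "(\<Sum>i\<in>UNIV. v i $ i) = (\<Sum>b\<in>B. \<Sum>i\<in>UNIV. (b $ i)\<^sup>2)"
      unfolding vi by (rule sum.swap)
    also have "\<dots> = (\<Sum>b\<in>B. b \<bullet> b)"
      by (simp add: inner_vec_def power2_eq_square)
    also have "\<dots> = dim S"
      using on B(5) by simp
    finally show "(\<Sum>i\<in>UNIV. v i $ i) = dim S" .
  qed
qed

text \<open>Here \<open>a\<close> is a row of the matrix and \<open>v\<close> a column of the projection onto the kernel, and
  \<open>x = v\<^sub>i\<close>. Since \<open>a\<^sub>i = 1\<close>, the relation \<open>a \<bullet> v = 0\<close> writes \<open>x\<close> in terms of the off-diagonal entries of
  both vectors, and those of \<open>v\<close> have square sum \<open>x - x\<^sup>2\<close>. Cauchy--Schwarz then gives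
  \<open>x\<^sup>2 \<le> (\<Sum>j\<noteq>i. a\<^sub>j\<^sup>2) (x - x\<^sup>2)\<close>, which excludes \<open>x = 1\<close> and bounds the square sum of the row below by
  \<open>x / (1 - x)\<close>. Subadditivity of \<open>t \<mapsto> t powr (p / 2)\<close> passes from squares to \<open>p\<close>-th powers.\<close>

lemma row_energy_bound:
  fixes a v :: "real ^ 'n" and p :: real
  assumes "a $ i = 1" and "a \<bullet> v = 0" and "v \<bullet> v = v $ i"
    and "0 < p" and "p \<le> 2"
  shows "0 \<le> v $ i" and "v $ i < 1"
    and "(v $ i / (1 - v $ i)) powr (p / 2) \<le> (\<Sum>j\<in>UNIV - {i}. \<bar>a $ j\<bar> powr p)"
proof -
  let ?J = "UNIV - {i}" and ?x = "v $ i"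
  let ?Q = "\<Sum>j\<in>?J. (a $ j)\<^sup>2"
  have split: "(\<Sum>j\<in>UNIV. f j) = f i + (\<Sum>j\<in>?J. f j)" for f :: "'n \<Rightarrow> real"
    by (rule sum.remove) auto
  have x: "?x = - (\<Sum>j\<in>?J. a $ j * v $ j)"
    using assms(1,2) split[of "\<lambda>j. a $ j * v $ j"] by (simp add: inner_vec_def)
  have v2: "(\<Sum>j\<in>?J. (v $ j)\<^sup>2) = ?x - ?x\<^sup>2"
    using assms(3) split[of "\<lambda>j. (v $ j)\<^sup>2"] by (simp add: inner_vec_def power2_eq_square)
  have "?x\<^sup>2 = (\<Sum>j\<in>?J. a $ j * v $ j)\<^sup>2" using x by (metis power2_minus)
  also have "\<dots> \<le> ?Q * (\<Sum>j\<in>?J. (v $ j)\<^sup>2)" by (rule Cauchy_Schwarz_ineq_sum)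
  finally have cs: "?x\<^sup>2 \<le> ?Q * (?x - ?x\<^sup>2)" unfolding v2 .
  show x0: "0 \<le> ?x" using assms(3) by (metis inner_ge_zero)
  have "0 \<le> ?x - ?x\<^sup>2" unfolding v2[symmetric] by (simp add: sum_nonneg)
  then have "?x * ?x \<le> 1 * ?x" by (simp add: power2_eq_square)
  then have "?x \<le> 1" using x0 by (cases "?x = 0") (auto simp: mult_le_cancel_right)
  moreover have "?x \<noteq> 1" using cs by auto
  ultimately show x1: "?x < 1" by simp
  have "?x / (1 - ?x) \<le> ?Q"
  proof (cases "?x = 0")
    case False
    with x0 have "?x > 0" by simp
    moreover have "?x * ?x \<le> ?x * (?Q * (1 - ?x))" using cs by (simp add: power2_eq_square algebra_simps)
    ultimately have "?x \<le> ?Q * (1 - ?x)" using mult_le_cancel_left_pos by blast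
    then show ?thesis using x1 by (simp add: field_simps)
  qed (simp add: sum_nonneg)
  then have "(?x / (1 - ?x)) powr (p / 2) \<le> ?Q powr (p / 2)"
    using x0 x1 assms(4) by (intro powr_mono2) auto
  also have "\<dots> \<le> (\<Sum>j\<in>?J. (a $ j)\<^sup>2 powr (p / 2))"
    using assms(4,5) by (intro powr_sum_subadditive) auto
  also have "\<dots> = (\<Sum>j\<in>?J. \<bar>a $ j\<bar> powr p)"
  proof (rule sum.cong)
    have "(y\<^sup>2) powr (p / 2) = \<bar>y\<bar> powr p" for y :: real
    proof -
      have "(y\<^sup>2) powr (p / 2) = (\<bar>y\<bar> powr 2) powr (p / 2)" by simp
      then show ?thesis by (simp only: powr_powr) simp
    qed
    then show "(a $ j)\<^sup>2 powr (p / 2) = \<bar>a $ j\<bar> powr p" for j .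
  qed simp
  finally show "(?x / (1 - ?x)) powr (p / 2) \<le> (\<Sum>j\<in>?J. \<bar>a $ j\<bar> powr p)" .
qed

lemma frame_energy_rows:
  fixes A :: "real ^ 'n ^ 'n"
  shows "frame_energy p A = (\<Sum>i\<in>UNIV. \<Sum>j\<in>UNIV - {i}. \<bar>A $ i $ j\<bar> powr p)"
proof -
  have "{(i, j). i \<noteq> j} = Sigma UNIV (\<lambda>i :: 'n. UNIV - {i})" by auto
  then show ?thesis unfolding frame_energy_def by (simp add: sum.Sigma)
qed

text \<open>The matrix enters the rest of the proof only through the numbers \<open>x i\<close>, the diagonal of the
  orthogonal projection onto its kernel.\<close>

lemma frame_energy_ge_kernel_sum:
  fixes A :: "real ^ 'n ^ 'n" and p :: real
  assumes "\<forall>i. A $ i $ i = 1" and "0 < p" and "p \<le> 2"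
  obtains x :: "'n \<Rightarrow> real" where
    "\<And>i. 0 \<le> x i" "\<And>i. x i < 1" "(\<Sum>i\<in>UNIV. x i) + rank A = CARD('n)"
    "(\<Sum>i\<in>UNIV. (x i / (1 - x i)) powr (p / 2)) \<le> frame_energy p A"
proof -
  let ?K = "{x. A *v x = 0}"
  have "subspace ?K"
    by (simp add: subspace_def matrix_vector_right_distrib matrix_vector_mult_scaleR)
  from projection_column[OF this] obtain v :: "'n \<Rightarrow> real ^ 'n"
    where v: "\<And>i. v i \<in> ?K" "\<And>i. v i \<bullet> v i = v i $ i" "(\<Sum>i\<in>UNIV. v i $ i) = dim ?K"
    by blast
  have orth: "A $ i \<bullet> v i = 0" for i
    using v(1)[of i] matrix_vector_mul_component[of A "v i" i] by simp
  note row = row_energy_bound[of "A $ i" i "v i" p for i]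
  show thesis
  proof (rule that[of "\<lambda>i. v i $ i"])
    show "(\<Sum>i\<in>UNIV. v i $ i) + rank A = CARD('n)"
      using dim_kernel[of A] v(3) by simp
    show "(\<Sum>i\<in>UNIV. (v i $ i / (1 - v i $ i)) powr (p / 2)) \<le> frame_energy p A"
      unfolding frame_energy_rows using assms orth v(2) by (intro sum_mono row) auto
  qed (use row assms orth v(2) in auto)
qed

section \<open>Linear minorants of powers of the odds\<close>

lemma powr_ge_tangent_at_1:
  fixes y p :: real
  assumes "0 \<le> y" "1 \<le> p"
  shows "1 + p * (y - 1) \<le> y powr p"
proof (cases "y = 0")
  case False
  have "((\<lambda>x. x powr p) has_field_derivative p) (at 1 within {0<..})"
    by (auto intro!: derivative_eq_intros)
  then have "y powr p - 1 powr p \<ge> p * (y - 1)"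
    using assms False
    by (intro convex_on_imp_above_tangent[OF powr_convex[OF assms(2)]]) (auto simp: interior_open)
  then show ?thesis by simp
qed (use assms in auto)

lemma two_x_le_sqrt_odds:
  fixes x :: real
  assumes "0 \<le> x" "x < 1"
  shows "2 * x \<le> (x / (1 - x)) powr (1 / 2)"
proof -
  have "(2 * x)\<^sup>2 * (1 - x) \<le> x"
  proof -
    have "x - (2 * x)\<^sup>2 * (1 - x) = x * (1 - 2 * x)\<^sup>2" by (simp add: power2_eq_square algebra_simps)
    also have "\<dots> \<ge> 0" using assms by simp
    finally show ?thesis by simp
  qed
  then have "(2 * x)\<^sup>2 \<le> x / (1 - x)" using assms by (simp add: field_simps)
  then show ?thesis using assms by (simp add: powr_half_sqrt real_le_rsqrt)
qed

text \<open>The left-hand side is the tangent at \<open>x = 1 / 2\<close>. For \<open>p = 1\<close> it is the line \<open>2 * x\<close>, and the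
  inequality is \<open>4 * x * (1 - x) \<le> 1\<close>; for larger \<open>p\<close>, raise that case to the power \<open>p\<close> and apply
  Bernoulli's inequality. Deriving the bound in this way makes it global, although for \<open>p < 2\<close> the
  function is not convex near \<open>0\<close>.\<close>

lemma odds_powr_ge_tangent_at_half:
  fixes x p :: real
  assumes "0 \<le> x" "x < 1" "1 \<le> p"
  shows "2 * p * x + (1 - p) \<le> (x / (1 - x)) powr (p / 2)"
proof -
  have "1 + p * (2 * x - 1) \<le> (2 * x) powr p"
    using assms by (intro powr_ge_tangent_at_1) auto
  also have "\<dots> \<le> ((x / (1 - x)) powr (1 / 2)) powr p"
    using assms two_x_le_sqrt_odds by (intro powr_mono2) auto
  finally show ?thesis by (simp add: powr_powr algebra_simps)
qed

lemma odds_powr_ge_two_x: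
  fixes x p :: real
  assumes "1 / 2 \<le> x" "x < 1" "1 \<le> p"
  shows "2 * x \<le> (x / (1 - x)) powr (p / 2)"
proof -
  have "2 * x \<le> (x / (1 - x)) powr (1 / 2)" using assms two_x_le_sqrt_odds by simp
  also have "\<dots> \<le> (x / (1 - x)) powr (p / 2)"
    using assms by (intro powr_mono) (auto simp: field_simps)
  finally show ?thesis .
qed

text \<open>The slope \<open>2 * p\<close> is that of the tangent at \<open>1 / 2\<close>. Near \<open>0\<close> the function grows like
  \<open>x powr (p / 2)\<close>, faster than any line through the origin; on \<open>[0, 1 / 10]\<close> the required
  slope is reached because \<open>10 powr (2 / 5) \<ge> 12 / 5\<close>.\<close>

lemma odds_powr_ge_steep_line:
  fixes x p :: real
  assumes "0 \<le> x" "x \<le> 1 / 10" "1 \<le> p" "p \<le> 6 / 5"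
  shows "2 * p * x \<le> (x / (1 - x)) powr (p / 2)"
proof (cases "x = 0")
  case False
  with assms have x: "x > 0" by simp
  have "2 * p \<le> 12 / 5" using assms by simp
  also have "12 / 5 \<le> (10 :: real) powr (2 / 5)"
  proof -
    have "(12 / 5) ^ 5 \<le> ((10 :: real) powr (2 / 5)) ^ 5"
      by (simp add: powr_power power_divide)
    then show ?thesis using power_le_imp_le_base[of "12 / 5 :: real" 4] by simp
  qed
  also have "\<dots> \<le> 10 powr (1 - p / 2)" using assms by (intro powr_mono) auto
  also have "\<dots> \<le> (1 / x) powr (1 - p / 2)" using assms x by (intro powr_mono2) (auto simp: field_simps)
  also have "\<dots> = x powr (p / 2) / x" using x by (simp add: powr_divide powr_diff)
  finally have "2 * p * x \<le> x powr (p / 2)" using x by (simp add: field_simps)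
  also have "\<dots> \<le> (x / (1 - x)) powr (p / 2)"
    using assms x by (intro powr_mono2) (auto simp: field_simps)
  finally show ?thesis .
qed simp

section \<open>Counting the large terms\<close>

text \<open>A single affine minorant of \<open>f\<close> cannot give the bound, because the number of indices at which
  \<open>x\<close> is large is a free parameter and only its integrality excludes bad values. So
  there are two minorants, each with an intercept that is paid only at large indices. When at most
  \<open>2 * m\<close> indices are large, the one with the intercept \<open>1 - p \<le> 0\<close> suffices; when at least
  \<open>2 * m + 1\<close> are, the one with the nonnegative intercept \<open>\<beta>\<close> does.\<close>

lemma sum_ge_by_counting:
  fixes f x :: "'b \<Rightarrow> real"
  assumes "finite I" and sum: "(\<Sum>i\<in>I. x i) = M" and M: "M = real m"
    and "1 \<le> p" and "0 \<le> \<beta>" and low: "\<alpha> * M + \<beta> * (2 * M + 1) \<ge> 2 * M"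
    and small: "\<And>i. i \<in> I \<Longrightarrow> x i \<le> c \<Longrightarrow> 2 * p * x i \<le> f i \<and> \<alpha> * x i \<le> f i"
    and large: "\<And>i. i \<in> I \<Longrightarrow> c < x i \<Longrightarrow> 2 * p * x i + (1 - p) \<le> f i \<and> \<alpha> * x i + \<beta> \<le> f i"
  shows "2 * M \<le> (\<Sum>i\<in>I. f i)"
proof -
  let ?L = "{i \<in> I. c < x i}"
  have line: "a * M + b * card ?L \<le> (\<Sum>i\<in>I. f i)"
    if "\<And>i. i \<in> I \<Longrightarrow> x i \<le> c \<Longrightarrow> a * x i \<le> f i"
      "\<And>i. i \<in> I \<Longrightarrow> c < x i \<Longrightarrow> a * x i + b \<le> f i" for a b
  proof -
    have "a * M + b * card ?L = (\<Sum>i\<in>I. a * x i + (if c < x i then b else 0))"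
      using assms(1) by (simp add: sum.distrib sum_distrib_left[symmetric] sum sum.If_cases Int_def)
    also have "\<dots> \<le> (\<Sum>i\<in>I. f i)" using that by (intro sum_mono) (auto simp: not_less)
    finally show ?thesis .
  qed
  show ?thesis
  proof (cases "card ?L \<le> 2 * m")
    case True
    then have "real (card ?L) \<le> 2 * M" unfolding M by (metis of_nat_le_iff of_nat_mult of_nat_numeral)
    then have "(p - 1) * card ?L \<le> (p - 1) * (2 * M)" using assms(4) by (intro mult_left_mono) auto
    then have "2 * M \<le> 2 * p * M + (1 - p) * card ?L" by (simp add: algebra_simps)
    also have "\<dots> \<le> (\<Sum>i\<in>I. f i)" using line small large by blast
    finally show ?thesis .
  next
    case False
    then have "2 * M + 1 \<le> card ?L" unfolding M by linarith
    then have "\<beta> * (2 * M + 1) \<le> \<beta> * card ?L" using assms(5) by (rule mult_left_mono)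
    then have "2 * M \<le> \<alpha> * M + \<beta> * card ?L" using low by linarith
    also have "\<dots> \<le> (\<Sum>i\<in>I. f i)" using line small large by blast
    finally show ?thesis .
  qed
qed

section \<open>The tangent at \<open>m / (2 m + 1)\<close>\<close>

locale critical_exponent =
  fixes M :: real
  assumes M: "1 \<le> M"
begin

definition \<sigma> :: real where "\<sigma> = ln ((2 * M + 1) / (2 * M)) / ln ((M + 1) / M)"

text \<open>For integral \<open>M\<close>, the number \<open>a\<close> is the common value of \<open>2 M + 1\<close> equal numbers with
  sum \<open>M\<close>. The exponent \<open>\<sigma>\<close> is half the upper bound for \<open>p\<close>, and it is the exponent at which \<open>2 M + 1\<close> such numbers attain
  the bound \<open>2 M\<close> exactly; this is what \<open>odds_a\<close> expresses.\<close>

definition a :: real where "a = M / (2 * M + 1)"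

lemma ln_pos: "0 < ln ((M + 1) / M)" using M by simp

lemma sigma_ge: "1 / 2 \<le> \<sigma>"
proof -
  have "ln ((M + 1) / M) \<le> ln (((2 * M + 1) / (2 * M)) ^ 2)"
  proof (subst ln_le_cancel_iff)
    have "(M + 1) / M \<le> 1 + 1 / M + (1 / (2 * M))\<^sup>2" using M by (simp add: field_simps)
    also have "\<dots> = ((2 * M + 1) / (2 * M))\<^sup>2" using M by (simp add: field_simps power2_eq_square)
    finally show "(M + 1) / M \<le> ((2 * M + 1) / (2 * M))\<^sup>2" .
  qed (use M in auto)
  also have "\<dots> = 2 * ln ((2 * M + 1) / (2 * M))" using M by (subst ln_realpow) auto
  finally show ?thesis using ln_pos by (simp add: \<sigma>_def field_simps)
qed

lemma sigma_le: "\<sigma> \<le> 3 / 5"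
proof -
  have "((2 * M + 1) / (2 * M)) ^ 5 \<le> ((M + 1) / M) ^ 3"
  proof -
    \<comment> \<open>in terms of \<open>1 / M\<close> this is a polynomial inequality on the unit interval\<close>
    define t where "t = 1 / M"
    have t: "0 < t" "t \<le> 1" using M by (auto simp: t_def)
    have e: "(2 * M + 1) / (2 * M) = 1 + t / 2" "(M + 1) / M = 1 + t"
      using M by (auto simp: t_def field_simps)
    have "(1 + t) ^ 3 - (1 + t / 2) ^ 5 = t * (1 / 2 + t / 2 - t\<^sup>2 / 4 - 5 * t ^ 3 / 16 - t ^ 4 / 32)"
      by (simp add: eval_nat_numeral field_simps)
    moreover have pow: "t ^ n \<le> t" if "1 \<le> n" for n
      using power_decreasing[OF that, of t] t by simp
    have "0 \<le> 1 / 2 + t / 2 - t\<^sup>2 / 4 - 5 * t ^ 3 / 16 - t ^ 4 / 32"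
      using t pow[of 2] pow[of 3] pow[of 4] by simp
    ultimately have "0 \<le> (1 + t) ^ 3 - (1 + t / 2) ^ 5" using t by simp
    then show ?thesis unfolding e by simp
  qed
  then have "ln (((2 * M + 1) / (2 * M)) ^ 5) \<le> ln (((M + 1) / M) ^ 3)"
    using M by (subst ln_le_cancel_iff) (auto)
  then have "5 * ln ((2 * M + 1) / (2 * M)) \<le> 3 * ln ((M + 1) / M)"
    using M by (simp add: ln_realpow)
  then show ?thesis using ln_pos by (simp add: \<sigma>_def field_simps)
qed

text \<open>With \<open>u = 1 + 1 / (2 M)\<close> and \<open>w = 1 + 1 / M\<close> the claim reads \<open>2 * u * ln u \<le> w * ln w\<close>. As
  \<open>u\<close> is the mean of \<open>1\<close> and \<open>w\<close>, it is the midpoint convexity of \<open>t * ln t\<close>. The claim makes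
  the intercept of the tangent below nonnegative and its slope at most \<open>2\<close>.\<close>

lemma sigma_le_one_minus_a: "\<sigma> \<le> 1 - a"
proof -
  let ?u = "(2 * M + 1) / (2 * M)" and ?w = "(M + 1) / M"
  have gap: "1 - u / w \<le> ln w - ln u" if "0 < u" "0 < w" for u w :: real
    using ln_le_minus_one[of "u / w"] that by (simp add: ln_div)
  have uw: "0 < ?u" "0 < ?w" using M by auto
  have "1 - ?u / ?w \<le> ln ?w - ln ?u" by (rule gap[OF uw])
  moreover have "1 - ?u \<le> - ln ?u" using gap[OF uw(1), of 1] by (simp del: ln_div ln_mult)
  ultimately have "?w * (1 - ?u / ?w) + (1 - ?u) \<le> ?w * (ln ?w - ln ?u) - ln ?u"
    using mult_left_mono[of "1 - ?u / ?w" "ln ?w - ln ?u" ?w] uw(2) by linarith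
  moreover have "?w * (1 - ?u / ?w) + (1 - ?u) = 0"
  proof -
    have "?w * (1 - ?u / ?w) = ?w - ?u" using uw(2) by (simp only: right_diff_distrib times_divide_eq_right mult_1_right) auto
    then show ?thesis using M by (simp add: field_simps)
  qed
  ultimately have "?w * (ln ?w - ln ?u) - ln ?u \<ge> 0" by linarith
  then have "(?w + 1) * ln ?u \<le> ?w * ln ?w" by (simp only: right_diff_distrib distrib_right mult_1)
  moreover have "c / d \<le> w / (w + 1)" if "(w + 1) * c \<le> w * d" "0 < d" "0 < w" for c d w :: real
    using that by (simp add: field_simps)
  ultimately have "ln ?u / ln ?w \<le> ?w / (?w + 1)" using ln_pos uw(2) by blast
  also have "\<dots> = 1 - a"
  proof -
    have "1 - a = (M + 1) / (2 * M + 1)" "?w + 1 = (2 * M + 1) / M" using M by (simp_all add: a_def field_simps)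
    then show ?thesis using M by simp
  qed
  finally show ?thesis by (simp add: \<sigma>_def)
qed

lemma a_bounds: "1 / 3 \<le> a" "a < 1 / 2" using M by (auto simp: a_def field_simps)

lemma odds_a: "(a / (1 - a)) powr \<sigma> = 2 * a"
proof -
  have "1 - a = (M + 1) / (2 * M + 1)" using M by (simp add: a_def field_simps)
  then have "a / (1 - a) = M / (M + 1)" using M by (simp add: a_def)
  moreover have "ln (M / (M + 1)) = - ln ((M + 1) / M)" using M by (simp add: ln_div)
  moreover have "\<sigma> * ln ((M + 1) / M) = ln ((2 * M + 1) / (2 * M))" using ln_pos by (simp add: \<sigma>_def)
  ultimately have "(a / (1 - a)) powr \<sigma> = exp (- ln ((2 * M + 1) / (2 * M)))" using M by (simp add: powr_def)
  also have "\<dots> = 2 * a" using M by (simp add: exp_minus a_def)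
  finally show ?thesis .
qed

text \<open>This is the tangent to \<open>(x / (1 - x)) powr \<sigma>\<close> at \<open>a\<close>, where that function has the value
  \<open>2 * a\<close>.\<close>

definition line :: "real \<Rightarrow> real" where
  "line x = 2 * a + 2 * \<sigma> / (1 - a) * (x - a)"

lemma line_alt: "line x = 2 * x + 2 * (1 - \<sigma> / (1 - a)) * (a - x)"
  by (simp add: line_def algebra_simps diff_divide_distrib)

text \<open>With \<open>e = \<sigma> - 1 / 2\<close>, both sides are compared with a function that is affine in \<open>e\<close>: the left
  side is affine in \<open>e\<close> for fixed \<open>M\<close>, the right side is convex, so it lies above its tangent at
  \<open>e = 0\<close>, where it equals \<open>1 / 3\<close>. The case \<open>M = 1\<close> is the tightest one.\<close>

lemma line_le_odds_powr_at_tenth: "line (1 / 10) \<le> (1 / 9) powr \<sigma>"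
proof -
  define e where "e = \<sigma> - 1 / 2"
  have e: "0 \<le> e" "e \<le> 1 / 10" using sigma_ge sigma_le by (auto simp: e_def)
  have "ln 9 \<le> (9 / 4 :: real)"
  proof -
    have "(3 :: real) \<le> (1 + 1 / 8 + (1 / 8)\<^sup>2 / 2) ^ 9" by (simp add: eval_nat_numeral)
    also have "\<dots> \<le> exp (1 / 8) ^ 9"
      by (intro power_mono exp_lower_Taylor_quadratic) auto
    also have "\<dots> = exp (9 / 8)" by (simp flip: exp_of_nat_mult)
    finally have "ln 3 \<le> (9 / 8 :: real)" using ln_le_cancel_iff[of 3 "exp (9 / 8) :: real"] by simp
    moreover have "ln 9 = 2 * ln (3 :: real)" using ln_realpow[of 3 2] by simp
    ultimately show ?thesis by simp
  qed
  then have "1 - 9 / 4 * e \<le> 1 + (- e * ln 9)" using mult_left_mono[OF _ e(1), of "ln 9" "9 / 4"] by simp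
  also have "\<dots> \<le> exp (- e * ln 9)" by (rule exp_ge_add_one_self)
  also have "\<dots> = 3 * (1 / 9) powr \<sigma>"
  proof -
    have "(1 / 9 :: real) powr \<sigma> = (1 / 9) powr (1 / 2) * (1 / 9) powr e"
      by (simp add: e_def flip: powr_add)
    moreover have "(1 / 9 :: real) powr (1 / 2) = 1 / 3" by (simp add: powr_half_sqrt real_sqrt_divide)
    moreover have "(1 / 9 :: real) powr e = exp (- e * ln 9)" by (simp add: powr_def ln_div)
    ultimately show ?thesis by simp
  qed
  finally have pow: "(1 - 9 / 4 * e) / 3 \<le> (1 / 9) powr \<sigma>" by simp
  have "line (1 / 10) \<le> (1 - 9 / 4 * e) / 3"
  proof -
    define q where "q = (8 * M - 1) / (5 * (2 * M + 1) * (M + 1))"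
    have "line (1 / 10) = 1 / 5 + (1 - \<sigma> / (1 - a)) * (2 * (a - 1 / 10))"
      unfolding line_alt by (simp only: mult_ac)
    also have "2 * (a - 1 / 10) = (M + 1) * q"
    proof -
      have "2 * (a - 1 / 10) = (8 * M - 1) / (5 * (2 * M + 1))"
        using M by (simp add: a_def divide_simps) (simp add: algebra_simps)
      then show ?thesis using M by (simp add: q_def)
    qed
    also have "1 - \<sigma> / (1 - a) = (1 / 2 - e * (2 * M + 1)) / (M + 1)"
    proof -
      have "1 - a = (M + 1) / (2 * M + 1)" using M by (simp add: a_def field_simps)
      then have "\<sigma> / (1 - a) = (1 / 2 + e) * (2 * M + 1) / (M + 1)" by (simp add: e_def)
      then show ?thesis using M by (simp add: field_simps)
    qed
    also have "(1 / 2 - e * (2 * M + 1)) / (M + 1) * ((M + 1) * q) = q / 2 - e * ((2 * M + 1) * q)"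
    proof -
      have cancel: "c / (M + 1) * ((M + 1) * q) = c * q" for c using M by simp
      show ?thesis unfolding cancel by (simp add: left_diff_distrib mult.assoc)
    qed
    also have "1 / 5 + \<dots> \<le> 1 / 5 + (7 / 60 - e * (7 / 10))"
    proof -
      \<comment> \<open>cross-multiplied, the bound on \<open>q\<close> is this product; equality holds at \<open>M = 1\<close>\<close>
      have "0 \<le> (M - 1) * (70 * M - 65)" using M by simp
      then have "135 * M \<le> 65 + 70 * (M * M)" by (simp only: algebra_simps)
      then have "q \<le> 7 / 30"
        unfolding q_def using M by (simp add: divide_simps) (simp add: algebra_simps)
      moreover have "7 / 10 \<le> (2 * M + 1) * q"
      proof -
        have "(2 * M + 1) * q = (8 * M - 1) / (5 * (M + 1))"
          unfolding q_def times_divide_eq_right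
          using M nonzero_mult_divide_mult_cancel_left[of "2 * M + 1" "8 * M - 1" "5 * (M + 1)"]
          by (simp only: mult_ac)
        also have "\<dots> \<ge> 7 / 10" using M by (simp add: divide_simps)
        finally show ?thesis .
      qed
      ultimately show ?thesis using mult_left_mono[OF _ e(1), of "7 / 10" "(2 * M + 1) * q"] by linarith
    qed
    also have "\<dots> \<le> (1 - 9 / 4 * e) / 3" using e by simp
    finally show ?thesis .
  qed
  with pow show ?thesis by simp
qed

text \<open>The function \<open>h\<close> below, the logarithm of the quotient of the two sides, has a derivative with
  the sign of \<open>(x - a) * (x - b)\<close>, because the numerator of the derivative is quadratic with a zero at
  the point of tangency. Hence \<open>h\<close> increases up to \<open>b\<close>, decreases to the value \<open>0\<close> at \<open>a\<close> and
  increases again; only its value at the left end of the interval remains to be checked.\<close>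

lemma line_le_odds_powr:
  assumes "1 / 10 \<le> x" "x \<le> 1 / 2"
  shows "line x \<le> (x / (1 - x)) powr \<sigma>"
proof -
  define h where "h x = \<sigma> * ln x - \<sigma> * ln (1 - x) - ln (line x)" for x
  \<comment> \<open>the second zero of the numerator of the derivative of \<open>h\<close>\<close>
  define b where "b = 1 - \<sigma> - a"
  have b: "b \<le> a" "0 \<le> b" using sigma_ge sigma_le_one_minus_a a_bounds by (auto simp: b_def)
  have line_pos: "0 < line y" if "0 < y" for y
  proof -
    have "line y = 2 * a * (1 - \<sigma> / (1 - a)) + 2 * \<sigma> / (1 - a) * y"
      by (simp add: line_def algebra_simps diff_divide_distrib)
    also have "\<dots> > 0" using a_bounds sigma_ge sigma_le_one_minus_a that by (intro add_nonneg_pos) auto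
    finally show ?thesis .
  qed
  have h0: "0 \<le> h y \<longleftrightarrow> line y \<le> (y / (1 - y)) powr \<sigma>" if "0 < y" "y < 1" for y
  proof -
    have "exp (h y) = (y / (1 - y)) powr \<sigma> / line y"
      using that line_pos[OF that(1)] by (simp add: h_def powr_def exp_diff ln_div right_diff_distrib)
    then show ?thesis using line_pos[OF that(1)]
      by (metis exp_le_cancel_iff exp_zero le_divide_eq_1_pos)
  qed
  define h' where "h' y = \<sigma> * (2 * ((y - a) * (y - b))) / ((1 - a) * line y * y * (1 - y))" for y
  have deriv: "(h has_real_derivative h' y) (at y)" if "0 < y" "y < 1" for y
  proof -
    have "(line has_real_derivative 2 * \<sigma> / (1 - a)) (at y)"
      unfolding line_def using a_bounds by (auto intro!: derivative_eq_intros)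
    note l = DERIV_chain2[OF DERIV_ln_divide[OF line_pos[OF that(1)]] this]
    have "((\<lambda>y. \<sigma> * ln y - \<sigma> * ln (1 - y)) has_real_derivative \<sigma> / y + \<sigma> / (1 - y)) (at y)"
      using that by (auto intro!: derivative_eq_intros)
    from DERIV_diff[OF this l]
    have "(h has_real_derivative \<sigma> / y + \<sigma> / (1 - y) - 2 * \<sigma> / (1 - a) / line y) (at y)"
      unfolding h_def by (simp add: mult.commute)
    also have "\<sigma> / y + \<sigma> / (1 - y) - 2 * \<sigma> / (1 - a) / line y = h' y"
    proof -
      have *: "(1 - a) * line y = 2 * (a * (1 - a) + \<sigma> * (y - a))" using a_bounds by (simp add: line_def field_simps)
      have "\<sigma> / y + \<sigma> / (1 - y) - 2 * \<sigma> / (1 - a) / line y = \<sigma> / (y * (1 - y)) - 2 * \<sigma> / ((1 - a) * line y)"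
        using that by (simp add: field_simps)
      also have "\<dots> = \<sigma> * ((1 - a) * line y - 2 * (y * (1 - y))) / ((1 - a) * line y * y * (1 - y))"
        using that line_pos[of y] a_bounds by (simp add: field_simps)
      also have "(1 - a) * line y - 2 * (y * (1 - y)) = 2 * ((y - a) * (y - b))"
        unfolding * b_def by (simp add: algebra_simps)
      finally show ?thesis by (simp only: h'_def)
    qed
    finally show ?thesis .
  qed
  have sgn: "\<exists>k > 0. h' y = k * ((y - a) * (y - b))" if "0 < y" "y < 1" for y
  proof (intro exI conjI)
    show "0 < 2 * \<sigma> / ((1 - a) * line y * y * (1 - y))"
      using that line_pos[of y] a_bounds sigma_ge by simp
    show "h' y = 2 * \<sigma> / ((1 - a) * line y * y * (1 - y)) * ((y - a) * (y - b))"
      unfolding h'_def times_divide_eq_left by (simp only: mult_ac)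
  qed
  have incr: "h u \<le> h w"
    if "0 < u" "u \<le> w" "w < 1" "\<And>y. u \<le> y \<Longrightarrow> y \<le> w \<Longrightarrow> 0 \<le> (y - a) * (y - b)" for u w
  proof (rule DERIV_nonneg_imp_nondecreasing[OF that(2)])
    fix y assume y: "u \<le> y" "y \<le> w"
    then have "0 < y" "y < 1" using that by linarith+
    then show "\<exists>d. (h has_real_derivative d) (at y) \<and> 0 \<le> d"
      using deriv[of y] sgn[of y] that(4)[OF y] by (metis mult_nonneg_nonneg less_imp_le)
  qed
  have decr: "h w \<le> h u"
    if "0 < u" "u \<le> w" "w < 1" "\<And>y. u \<le> y \<Longrightarrow> y \<le> w \<Longrightarrow> (y - a) * (y - b) \<le> 0" for u w
  proof (rule DERIV_nonpos_imp_nonincreasing[OF that(2)])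
    fix y assume y: "u \<le> y" "y \<le> w"
    then have "0 < y" "y < 1" using that by linarith+
    then show "\<exists>d. (h has_real_derivative d) (at y) \<and> d \<le> 0"
      using deriv[of y] sgn[of y] that(4)[OF y] by (metis mult_nonneg_nonpos less_imp_le)
  qed
  have ha: "h a = 0"
  proof -
    have "exp (h a) = (a / (1 - a)) powr \<sigma> / line a"
      using a_bounds line_pos[of a] by (simp add: h_def powr_def exp_diff ln_div right_diff_distrib)
    then show ?thesis using odds_a a_bounds by (simp add: line_def)
  qed
  have hc: "0 \<le> h (1 / 10)" using line_le_odds_powr_at_tenth by (simp add: h0)
  have "0 \<le> h x"
  proof -
    consider "a \<le> x" | "b \<le> x" "x \<le> a" | "x \<le> b" by linarith
    then show ?thesis
    proof cases
      case 1
      have "h a \<le> h x" using 1 assms a_bounds b by (intro incr mult_nonneg_nonneg) auto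
      with ha show ?thesis by simp
    next
      case 2
      have "h a \<le> h x" using 2 assms a_bounds by (intro decr mult_nonpos_nonneg) auto
      with ha show ?thesis by simp
    next
      case 3
      have "h (1 / 10) \<le> h x" using 3 assms b by (intro incr mult_nonpos_nonpos) auto
      with hc show ?thesis by simp
    qed
  qed
  then show ?thesis using assms h0 by simp
qed

text \<open>The tangent at \<open>a\<close> was built for the exponent \<open>\<sigma>\<close>, but it serves every \<open>p\<close> in the range. On
  \<open>x \<le> 1 / 2\<close> the odds are at most \<open>1\<close>, so a smaller exponent gives a larger power; on
  \<open>x \<ge> 1 / 2\<close> the tangent lies below \<open>2 * x\<close>.\<close>

lemma sum_odds_powr_ge:
  fixes x :: "'b \<Rightarrow> real"
  assumes "finite I" "\<And>i. i \<in> I \<Longrightarrow> 0 \<le> x i" "\<And>i. i \<in> I \<Longrightarrow> x i < 1"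
    and "(\<Sum>i\<in>I. x i) = M" "M = real m" "1 \<le> p" "p \<le> 2 * \<sigma>"
  shows "2 * M \<le> (\<Sum>i\<in>I. (x i / (1 - x i)) powr (p / 2))"
proof (rule sum_ge_by_counting[where c = "1 / 10" and x = x and p = p and \<alpha> = "2 * \<sigma> / (1 - a)"
      and \<beta> = "2 * a * (1 - \<sigma> / (1 - a))"])
  have ratio: "\<sigma> / (1 - a) \<le> 1" using sigma_le_one_minus_a a_bounds by (simp add: pos_divide_le_eq)
  then have slope: "2 * \<sigma> / (1 - a) \<le> 2" by simp
  show "0 \<le> 2 * a * (1 - \<sigma> / (1 - a))" using ratio a_bounds by (intro mult_nonneg_nonneg) auto
  have aM: "a * (2 * M + 1) = M" using M by (simp add: a_def)
  have "2 * \<sigma> / (1 - a) * M + 2 * a * (1 - \<sigma> / (1 - a)) * (2 * M + 1)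
      = 2 * \<sigma> / (1 - a) * M + 2 * (1 - \<sigma> / (1 - a)) * (a * (2 * M + 1))" by simp
  also have "\<dots> = 2 * M" unfolding aM by (simp add: algebra_simps)
  finally show "2 * M \<le> 2 * \<sigma> / (1 - a) * M + 2 * a * (1 - \<sigma> / (1 - a)) * (2 * M + 1)" by simp
  have p: "p \<le> 6 / 5" using assms(7) sigma_le by simp
  show "2 * p * x i \<le> (x i / (1 - x i)) powr (p / 2) \<and> 2 * \<sigma> / (1 - a) * x i \<le> (x i / (1 - x i)) powr (p / 2)"
    if "i \<in> I" "x i \<le> 1 / 10" for i
  proof -
    have 1: "2 * p * x i \<le> (x i / (1 - x i)) powr (p / 2)"
      using assms that p by (intro odds_powr_ge_steep_line) auto
    have "2 * \<sigma> / (1 - a) * x i \<le> 2 * p * x i"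
      using slope assms(2,6) that by (intro mult_right_mono) auto
    with 1 show ?thesis by simp
  qed
  show "2 * p * x i + (1 - p) \<le> (x i / (1 - x i)) powr (p / 2)
     \<and> 2 * \<sigma> / (1 - a) * x i + 2 * a * (1 - \<sigma> / (1 - a)) \<le> (x i / (1 - x i)) powr (p / 2)"
    if "i \<in> I" "1 / 10 < x i" for i
  proof
    show "2 * p * x i + (1 - p) \<le> (x i / (1 - x i)) powr (p / 2)"
      using assms that by (intro odds_powr_ge_tangent_at_half) auto
    have "2 * \<sigma> / (1 - a) * x i + 2 * a * (1 - \<sigma> / (1 - a)) = line (x i)"
      by (simp add: line_def algebra_simps diff_divide_distrib)
    also have "\<dots> \<le> (x i / (1 - x i)) powr (p / 2)"
    proof (cases "x i \<le> 1 / 2")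
      case True
      have "line (x i) \<le> (x i / (1 - x i)) powr \<sigma>" using line_le_odds_powr True that by simp
      also have "\<dots> \<le> (x i / (1 - x i)) powr (p / 2)"
        using True that assms(7) by (intro powr_mono') auto
      finally show ?thesis .
    next
      case False
      have "line (x i) \<le> 2 * x i"
        unfolding line_alt using mult_nonneg_nonpos[of "2 * (1 - \<sigma> / (1 - a))" "a - x i"] ratio a_bounds False by simp
      also have "\<dots> \<le> (x i / (1 - x i)) powr (p / 2)"
        using assms that False by (intro odds_powr_ge_two_x) auto
      finally show ?thesis .
    qed
    finally show "2 * \<sigma> / (1 - a) * x i + 2 * a * (1 - \<sigma> / (1 - a)) \<le> (x i / (1 - x i)) powr (p / 2)" .
  qed
qed (use assms in auto)

end

theorem theorem3p2:
  fixes m d :: nat and p :: real and A :: "real ^ 'n ^ 'n"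
  assumes "1 \<le> m" and "m < d"
    and "p \<in> {1 .. 2 * ln ((2 * real m + 1) / (2 * real m)) / ln ((real m + 1) / real m)}"
    and "CARD('n) = d + m"
    and "rank A = d"
    and "\<forall>i. A $ i $ i = 1"
  shows "frame_energy p A \<ge> 2 * real m"
proof -
  interpret C: critical_exponent "real m" using assms(1) by unfold_locales simp
  have p: "1 \<le> p" "p \<le> 2 * C.\<sigma>" using assms(3) by (auto simp: C.\<sigma>_def)
  then have "0 < p" "p \<le> 2" using C.sigma_le by simp_all
  then obtain x :: "'n \<Rightarrow> real" where x: "\<And>i. 0 \<le> x i" "\<And>i. x i < 1"
      "(\<Sum>i\<in>UNIV. x i) + rank A = CARD('n)"
      "(\<Sum>i\<in>UNIV. (x i / (1 - x i)) powr (p / 2)) \<le> frame_energy p A"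
    using frame_energy_ge_kernel_sum[OF assms(6)] by metis
  have "(\<Sum>i\<in>UNIV. x i) = real m" using x(3) assms(4,5) by simp
  then have "2 * real m \<le> (\<Sum>i\<in>UNIV. (x i / (1 - x i)) powr (p / 2))"
    using x(1,2) p by (intro C.sum_odds_powr_ge) auto
  with x(4) show ?thesis by simp
qed

end
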